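(* Let $(\mathbb{X},d)$ be a metric space, let $f:\mathbb{R}\to\mathbb{X}$ be continuous, and let $\mu$ be a Borel measure on $\mathbb{R}$ such that $\mu(\mathbb{R})=\infty$ and $\mu(I)<\infty$ for every bounded interval $I$. The following are equivalent. (i) $f$ is $\mu$-pseudo almost automorphic in the wide sense, i.e. there exists an almost automorphic function $g:\mathbb{R}\to\mathbb{X}$ such that $$\lim_{r\to\infty}\frac{1}{\mu([-r,r])}\int_{[-r,r]}\bigl(d(f(t),g(t))\wedge 1\bigr)\,d\mu(t)=0.$$ (ii) There exists an almost automorphic function $g:\mathbb{R}\to\mathbb{X}$ such that, for any finite family $U_1,\dots,U_m$ of open subsets of $\mathbb{X}$ covering the closure $K$ of $\{g(t);\,t\in\mathbb{R}\}$, $$\lim_{r\to\infty}\frac{\mu\{t\in[-r,r];\ (f(t),g(t))\notin V\}}{\mu([-r,r])}=0,$$ where $V=\bigcup_{i=1}^m (U_i\times U_i)$.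
   Context: A continuous function $g:\mathbb{R}\to\mathbb{X}$ is almost automorphic if every real sequence $(t'_n)$ has a subsequence $(t_n)$ such that for every $t\in\mathbb{R}$ the limit $k(t)=\lim_n g(t+t_n)$ exists and $\lim_n k(t-t_n)=g(t)$. Here $a\wedge b=\min(a,b)$. *)

theory Defs
  imports "HOL-Analysis.Analysis"
begin

definition almost_automorphic :: "(real \<Rightarrow> 'a::metric_space) \<Rightarrow> bool" where
  "almost_automorphic g \<longleftrightarrow>
     continuous_on UNIV g \<and>
     (\<forall>t' :: nat \<Rightarrow> real. \<exists>\<phi> :: nat \<Rightarrow> nat. strict_mono \<phi> \<and>
        (\<exists>k :: real \<Rightarrow> 'a. \<forall>t.
           (\<lambda>n. g (t + t' (\<phi> n))) \<longlonglongrightarrow> k t \<and>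
           (\<lambda>n. k (t - t' (\<phi> n))) \<longlonglongrightarrow> g t))"

definition pseudo_almost_automorphic_wide ::
  "real measure \<Rightarrow> (real \<Rightarrow> 'a::metric_space) \<Rightarrow> bool" where
  "pseudo_almost_automorphic_wide \<mu> f \<longleftrightarrow>
     (\<exists>g. almost_automorphic g \<and>
        ((\<lambda>r. 1 / measure \<mu> {-r..r} * (LINT t:{-r..r}|\<mu>. min (dist (f t) (g t)) 1))
           \<longlongrightarrow> 0) at_top)"

end

theory Submission
  imports Defs
begin

text \<open>
  The range of an almost automorphic function is relatively compact. Hence a finite open cover of
  the closure of \<open>range g\<close> has a Lebesgue number, so the pairs outside \<open>V\<close> are at distance bounded
  below and Markov's inequality applies. Conversely, a finite cover by balls of radius \<open>\<epsilon>/2\<close> forces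
  \<open>dist (f t) (g t) < \<epsilon>\<close> whenever \<open>(f t, g t) \<in> V\<close>, so the mean of the truncated distance is at most
  \<open>\<epsilon>\<close> plus the relative measure of the exceptional set.
\<close>

text \<open>Sequential compactness suffices. A sequence in the closure is replaced by nearby values
  \<open>g (t n)\<close>, and almost automorphy applied to the sequence \<open>t\<close> itself
  yields a subsequence along which these values converge.\<close>

lemma almost_automorphic_compact_closure_range:
  fixes g :: "real \<Rightarrow> 'a::metric_space"
  assumes "almost_automorphic g"
  shows "compact (closure (range g))"
  unfolding compact_eq_seq_compact_metric seq_compact_def
proof (intro allI impI)
  fix s :: "nat \<Rightarrow> 'a"
  assume s: "\<forall>n. s n \<in> closure (range g)"
  have "\<exists>t. dist (g t) (s n) < inverse (real (Suc n))" for n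
    using s[rule_format, of n] unfolding closure_approachable by force
  then obtain t where t: "\<And>n. dist (g (t n)) (s n) < inverse (real (Suc n))"
    by metis
  obtain \<phi> :: "nat \<Rightarrow> nat" and k where \<phi>: "strict_mono \<phi>"
    and k: "\<And>u. (\<lambda>n. g (u + t (\<phi> n))) \<longlonglongrightarrow> k u"
    using assms unfolding almost_automorphic_def by metis
  \<comment> \<open>Evaluating the pointwise limit at the base point 0 turns translates of
    \<open>g\<close> into the values \<open>g (t (\<phi> n))\<close>.\<close>
  have gk: "(\<lambda>n. g (t (\<phi> n))) \<longlonglongrightarrow> k 0"
    using k[of 0] by simp
  have "(\<lambda>n. dist (g (t n)) (s n)) \<longlonglongrightarrow> 0"
    using t by (intro tendsto_sandwich[OF _ _ tendsto_const LIMSEQ_inverse_real_of_nat])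
      (auto intro!: always_eventually less_imp_le)
  then have "(\<lambda>n. dist (g (t (\<phi> n))) (s (\<phi> n))) \<longlonglongrightarrow> 0"
    by (rule LIMSEQ_subseq_LIMSEQ[OF _ \<phi>, unfolded o_def])
  \<comment> \<open>With \<open>g (t (\<phi> n))\<close> as intermediate point, the sum of the two
    distances bounds \<open>dist (s (\<phi> n)) (k 0)\<close>.\<close>
  from tendsto_add[OF this gk[THEN tendsto_dist_iff[THEN iffD1]]]
  have "(\<lambda>n. dist (g (t (\<phi> n))) (s (\<phi> n)) + dist (g (t (\<phi> n))) (k 0)) \<longlonglongrightarrow> 0"
    by simp
  then have "(\<lambda>n. dist (s (\<phi> n)) (k 0)) \<longlonglongrightarrow> 0"
    by (rule tendsto_sandwich[OF _ _ tendsto_const, rotated 2]) (simp_all add: dist_triangle3)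
  then have "(\<lambda>n. s (\<phi> n)) \<longlonglongrightarrow> k 0"
    by (rule tendsto_dist_iff[THEN iffD2])
  moreover have "k 0 \<in> closure (range g)"
    unfolding closure_sequential using gk by (intro exI[of _ "\<lambda>n. g (t (\<phi> n))"]) simp
  ultimately show "\<exists>l\<in>closure (range g). \<exists>r. strict_mono r \<and> (s \<circ> r) \<longlonglongrightarrow> l"
    using \<phi> by (auto simp: o_def)
qed

text \<open>The indicator of \<open>I\<close> is an integrable majorant because \<open>I\<close> has
  finite measure. This supplies the integrability that monotonicity of the Bochner integral
  requires.\<close>

lemma set_integrable_unit_bounded:
  fixes h :: "'b \<Rightarrow> real"
  assumes "h \<in> borel_measurable M" "I \<in> sets M" "emeasure M I < \<infinity>" "\<And>t. 0 \<le> h t" "\<And>t. h t \<le> 1"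
  shows "set_integrable M I h"
proof -
  have "integrable M (indicator I :: 'b \<Rightarrow> real)"
    using assms(2,3) by (rule integrable_real_indicator)
  then show ?thesis
    unfolding set_integrable_def
  proof (rule Bochner_Integration.integrable_bound)
    show "(\<lambda>x. indicat_real I x *\<^sub>R h x) \<in> borel_measurable M"
      using assms(1,2) by measurable
    show "AE x in M. norm (indicat_real I x *\<^sub>R h x) \<le> norm (indicator I x :: real)"
      using assms(4,5) by (simp add: indicator_def)
  qed
qed

text \<open>Markov's inequality, obtained by integrating the pointwise bound
  \<open>c * indicator B t \<le> indicator I t * h t\<close>.\<close>

lemma set_integral_ge_const_times_measure:
  fixes h :: "'b \<Rightarrow> real"
  assumes "h \<in> borel_measurable M" "I \<in> sets M" "emeasure M I < \<infinity>" "\<And>t. 0 \<le> h t" "\<And>t. h t \<le> 1"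
    and "B \<in> sets M" "B \<subseteq> I" "\<And>t. t \<in> B \<Longrightarrow> c \<le> h t"
  shows "c * measure M B \<le> (LINT t:I|M. h t)"
proof -
  have fin: "emeasure M B < \<infinity>"
    using emeasure_mono[OF assms(7,2)] assms(3) by (rule le_less_trans)
  have int: "integrable M (\<lambda>t. c * indicator B t)"
    using assms(6) fin by simp
  have "c * indicator B t \<le> indicator I t * h t" for t
    using assms(4,8)[of t] assms(7) by (auto split: split_indicator)
  then have "(LINT t|M. c * indicator B t) \<le> (LINT t:I|M. h t)"
    unfolding set_lebesgue_integral_def
    using set_integrable_unit_bounded[OF assms(1-5)] int
    by (intro integral_mono) (simp_all add: set_integrable_def)
  moreover have "(LINT t|M. c * indicator B t) = c * measure M B"
    using assms(6) sets.sets_into_space[OF assms(6)] by (simp add: Int_absorb2)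
  ultimately show ?thesis
    by (simp only:)
qed

text \<open>The integrand is at most \<open>\<epsilon>\<close> off \<open>B\<close> and at most 1 on
  \<open>B\<close>, so it is dominated on \<open>I\<close> by \<open>\<epsilon>\<close> plus the
  indicator of \<open>B\<close>.\<close>

lemma set_integral_le_split:
  fixes h :: "'b \<Rightarrow> real"
  assumes "h \<in> borel_measurable M" "I \<in> sets M" "emeasure M I < \<infinity>" "\<And>t. 0 \<le> h t" "\<And>t. h t \<le> 1"
    and "B \<in> sets M" "B \<subseteq> I" "\<And>t. t \<in> I - B \<Longrightarrow> h t \<le> \<epsilon>" "0 \<le> \<epsilon>"
  shows "(LINT t:I|M. h t) \<le> \<epsilon> * measure M I + measure M B"
proof -
  have fin: "emeasure M B < \<infinity>"
    using emeasure_mono[OF assms(7,2)] assms(3) by (rule le_less_trans)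
  have int: "integrable M (\<lambda>t. \<epsilon> * indicator I t)" "integrable M (indicator B :: 'b \<Rightarrow> real)"
    using assms(2,3,6) fin by simp_all
  have "indicator I t * h t \<le> \<epsilon> * indicator I t + indicator B t" for t
    using assms(5,8)[of t] assms(7) \<open>0 \<le> \<epsilon>\<close> by (cases "t \<in> B") (auto split: split_indicator)
  then have "(LINT t:I|M. h t) \<le> (LINT t|M. \<epsilon> * indicator I t + indicator B t)"
    unfolding set_lebesgue_integral_def
    using set_integrable_unit_bounded[OF assms(1-5)] int
    by (intro integral_mono Bochner_Integration.integrable_add) (simp_all add: set_integrable_def)
  also have "\<dots> = \<epsilon> * measure M I + measure M B"
    using int assms(2,6) sets.sets_into_space[OF assms(2)] sets.sets_into_space[OF assms(6)]
    by (simp add: Int_absorb2)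
  finally show ?thesis .
qed

text \<open>By continuity the times whose pair lies in some square \<open>U i \<times> U i\<close>
  form an open set, and the exceptional set is \<open>I\<close> minus that open set.\<close>

lemma sets_pair_notin_squares:
  fixes f g :: "real \<Rightarrow> 'a::topological_space"
  assumes "continuous_on UNIV f" "continuous_on UNIV g" "\<forall>i\<in>J. open (U i)" "I \<in> sets borel"
  shows "{t \<in> I. (f t, g t) \<notin> (\<Union>i\<in>J. U i \<times> U i)} \<in> sets borel"
proof -
  have "open (\<Union>i\<in>J. f -` U i \<inter> g -` U i)"
    using assms by (auto intro!: open_vimage)
  moreover have "{t \<in> I. (f t, g t) \<notin> (\<Union>i\<in>J. U i \<times> U i)} = I - (\<Union>i\<in>J. f -` U i \<inter> g -` U i)"
    by auto
  ultimately show ?thesis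
    using assms(4) by auto
qed

theorem proposition2p5:
  fixes f :: "real \<Rightarrow> 'a::metric_space"
    and \<mu> :: "real measure"
  assumes "continuous_on UNIV f"
    and "sets \<mu> = sets borel"
    and "emeasure \<mu> UNIV = \<infinity>"
    and "\<And>I. is_interval I \<Longrightarrow> bounded I \<Longrightarrow> emeasure \<mu> I < \<infinity>"
  shows "pseudo_almost_automorphic_wide \<mu> f \<longleftrightarrow>
    (\<exists>g. almost_automorphic g \<and>
      (\<forall>(m::nat) (U :: nat \<Rightarrow> 'a set).
         (\<forall>i\<in>{1..m}. open (U i)) \<and> closure (range g) \<subseteq> (\<Union>i\<in>{1..m}. U i) \<longrightarrow>
         ((\<lambda>r. measure \<mu> {t \<in> {-r..r}. (f t, g t) \<notin> (\<Union>i\<in>{1..m}. U i \<times> U i)}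
               / measure \<mu> {-r..r}) \<longlongrightarrow> 0) at_top))"
proof -
  define B where "B g m U r = {t \<in> {-r..r}. (f t, g t) \<notin> (\<Union>i\<in>{1..m}. U i \<times> U i)}"
    for g and m :: nat and U :: "nat \<Rightarrow> 'a set" and r :: real
  have I: "{-r..r} \<in> sets \<mu>" "emeasure \<mu> {-r..r} < \<infinity>" for r
    using assms(2) assms(4)[OF is_interval_cc bounded_closed_interval] by simp_all
  \<comment> \<open>The two limit conditions are equivalent for each fixed \<open>g\<close>, so the
    same function witnesses both sides of the theorem.\<close>
  have "((\<lambda>r. 1 / measure \<mu> {-r..r} * (LINT t:{-r..r}|\<mu>. min (dist (f t) (g t)) 1)) \<longlongrightarrow> 0) at_top
    \<longleftrightarrow> (\<forall>m U. (\<forall>i\<in>{1..m}. open (U i)) \<and> closure (range g) \<subseteq> (\<Union>i\<in>{1..m}. U i) \<longrightarrow>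
         ((\<lambda>r. measure \<mu> (B g m U r) / measure \<mu> {-r..r}) \<longlongrightarrow> 0) at_top)"
    (is "?L \<longleftrightarrow> ?R") if g: "almost_automorphic g" for g
  proof -
    define h where "h t = min (dist (f t) (g t)) 1" for t
    have cg: "continuous_on UNIV g"
      using g by (simp add: almost_automorphic_def)
    have "h \<in> borel_measurable borel"
      unfolding h_def by (intro borel_measurable_continuous_onI continuous_intros assms(1) cg)
    then have h: "h \<in> borel_measurable \<mu>" "\<And>t. 0 \<le> h t" "\<And>t. h t \<le> 1"
      by (simp_all add: h_def measurable_cong_sets[OF assms(2) refl])
    have B: "B g m U r \<in> sets \<mu>" "B g m U r \<subseteq> {-r..r}" if "\<forall>i\<in>{1..m}. open (U i)" for m U r
      using sets_pair_notin_squares[OF assms(1) cg that, of "{-r..r}"] assms(2)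
      by (auto simp: B_def)
    have K: "compact (closure (range g))"
      using g by (rule almost_automorphic_compact_closure_range)
    have gK: "g t \<in> closure (range g)" for t
      using closure_subset[of "range g"] by blast
    show ?thesis
    proof
      assume L: ?L
      show ?R
      proof (intro allI impI, elim conjE)
        fix m :: nat and U :: "nat \<Rightarrow> 'a set"
        assume U: "\<forall>i\<in>{1..m}. open (U i)" and cover: "closure (range g) \<subseteq> (\<Union>i\<in>{1..m}. U i)"
        \<comment> \<open>\<open>\<delta>\<close> is a Lebesgue number of the cover of the compact
          closure.\<close>
        obtain \<delta> where "\<delta> > 0"
          and \<delta>: "\<And>x. x \<in> closure (range g) \<Longrightarrow> \<exists>G\<in>U ` {1..m}. ball x \<delta> \<subseteq> G"
          using Heine_Borel_lemma[OF K, of "U ` {1..m}"] U cover by auto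
        \<comment> \<open>The cap at 1 matches the truncation: \<open>h t < c\<close> then forces
          \<open>h t = dist (f t) (g t)\<close>, and this distance is below
          \<open>\<delta>\<close>.\<close>
        define c where "c = min \<delta> 1"
        have c: "c > 0" using \<open>\<delta> > 0\<close> by (simp add: c_def)
        have "c \<le> h t" if "t \<in> B g m U r" for t r
        proof (rule ccontr)
          assume "\<not> c \<le> h t"
          then have "f t \<in> ball (g t) \<delta>" "g t \<in> ball (g t) \<delta>"
            using \<open>\<delta> > 0\<close> by (auto simp: c_def h_def dist_commute)
          then show False
            \<comment> \<open>One member of the cover contains the whole ball about
              \<open>g t\<close>, hence both points, so the pair lies in its square.\<close>
            using \<delta>[OF gK, of t] that unfolding B_def by blast
        qed
        then have "c * measure \<mu> (B g m U r) \<le> (LINT t:{-r..r}|\<mu>. h t)" for r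
          by (intro set_integral_ge_const_times_measure h I B U)
        then have "measure \<mu> (B g m U r) \<le> (LINT t:{-r..r}|\<mu>. h t) / c" for r
          using c by (simp add: field_simps)
        \<comment> \<open>Intervals of measure 0 need no separate case, since division by 0 gives 0
          on both sides.\<close>
        then have le: "measure \<mu> (B g m U r) / measure \<mu> {-r..r}
            \<le> (1 / measure \<mu> {-r..r} * (LINT t:{-r..r}|\<mu>. h t)) / c" for r
          using divide_right_mono[of "measure \<mu> (B g m U r)" "(LINT t:{-r..r}|\<mu>. h t) / c"
              "measure \<mu> {-r..r}"] by (simp add: mult.commute)
        have "((\<lambda>r. (1 / measure \<mu> {-r..r} * (LINT t:{-r..r}|\<mu>. h t)) / c) \<longlongrightarrow> 0) at_top"
          using tendsto_divide[OF L tendsto_const, of c] c by (simp add: h_def)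
        then show "((\<lambda>r. measure \<mu> (B g m U r) / measure \<mu> {-r..r}) \<longlongrightarrow> 0) at_top"
          by (rule tendsto_sandwich[OF _ _ tendsto_const, rotated 2])
            (use le in \<open>simp_all add: always_eventually\<close>)
      qed
    next
      assume R: ?R
      show ?L
      proof (rule tendstoI)
        fix e :: real
        assume "e > 0"
        \<comment> \<open>One half of \<open>e\<close> bounds the mean over the good times, the
          other the relative measure of the exceptional set.\<close>
        define \<epsilon> where "\<epsilon> = e / 2"
        have "\<epsilon> > 0" using \<open>e > 0\<close> by (simp add: \<epsilon>_def)
        obtain X where X: "finite X" "closure (range g) \<subseteq> (\<Union>x\<in>X. ball x (\<epsilon> / 2))"
          using K \<open>\<epsilon> > 0\<close> unfolding compact_eq_totally_bounded by (meson half_gt_zero)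
        \<comment> \<open>The finite set of centres is enumerated to obtain a cover indexed by
          \<open>{1..m}\<close>, the form in which \<open>R\<close> can be applied.\<close>
        obtain p where p: "p ` {1..card X} = X"
          using ex_bij_betw_nat_finite_1[OF X(1)] by (auto simp: bij_betw_def)
        define m U where "m = card X" and "U = (\<lambda>i. ball (p i) (\<epsilon> / 2))"
        have U: "\<forall>i\<in>{1..m}. open (U i)"
          by (simp add: U_def)
        have cover: "closure (range g) \<subseteq> (\<Union>i\<in>{1..m}. U i)"
        proof
          fix y
          assume "y \<in> closure (range g)"
          then obtain x where x: "x \<in> X" "y \<in> ball x (\<epsilon> / 2)"
            using X(2) by blast
          then obtain i where "i \<in> {1..m}" "x = p i"
            using p unfolding m_def by blast
          then show "y \<in> (\<Union>i\<in>{1..m}. U i)"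
            using x(2) unfolding U_def by blast
        qed
        have "h t \<le> \<epsilon>" if t: "t \<in> {-r..r} - B g m U r" for t r
        proof -
          obtain i where "f t \<in> U i" "g t \<in> U i"
            using t unfolding B_def by blast
          then have "dist (f t) (g t) < \<epsilon>"
            unfolding U_def mem_ball by (rule dist_triangle_half_r)
          then show ?thesis
            by (simp add: h_def)
        qed
        then have le: "(LINT t:{-r..r}|\<mu>. h t) \<le> \<epsilon> * measure \<mu> {-r..r} + measure \<mu> (B g m U r)" for r
          using \<open>\<epsilon> > 0\<close> by (intro set_integral_le_split h I B U) simp_all
        have "((\<lambda>r. measure \<mu> (B g m U r) / measure \<mu> {-r..r}) \<longlongrightarrow> 0) at_top"
          using R U cover by blast
        then have "eventually (\<lambda>r. measure \<mu> (B g m U r) / measure \<mu> {-r..r} < \<epsilon>) at_top"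
          using \<open>\<epsilon> > 0\<close> by (rule order_tendstoD)
        then show "eventually (\<lambda>r. dist (1 / measure \<mu> {-r..r} *
            (LINT t:{-r..r}|\<mu>. min (dist (f t) (g t)) 1)) 0 < e) at_top"
        proof eventually_elim
          case (elim r)
          have "0 \<le> (LINT t:{-r..r}|\<mu>. h t)"
            using h(2) by (simp add: set_lebesgue_integral_def)
          moreover have "(LINT t:{-r..r}|\<mu>. h t) / measure \<mu> {-r..r}
              \<le> (\<epsilon> * measure \<mu> {-r..r} + measure \<mu> (B g m U r)) / measure \<mu> {-r..r}"
            by (rule divide_right_mono[OF le]) simp
          \<comment> \<open>Equality holds when the interval has positive measure; if its measure is
            0, the left side is 0 and only the inequality remains.\<close>
          moreover have "\<dots> \<le> \<epsilon> + measure \<mu> (B g m U r) / measure \<mu> {-r..r}"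
            using \<open>\<epsilon> > 0\<close> by (cases "measure \<mu> {-r..r} = 0") (auto simp: add_divide_distrib)
          ultimately show ?case
            using elim by (simp add: h_def \<epsilon>_def)
        qed
      qed
    qed
  qed
  then show ?thesis
    unfolding pseudo_almost_automorphic_wide_def B_def by (intro ex_cong1 conj_cong refl) simp
qed

end
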